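(* Let $p\ge 1$, $\alpha>0$, $\beta\in(0,1]$, and let $f,g$ be two positive functions on $[1,\infty)$ such that for all $x>1$, $\mathcal{H}^{\alpha,\beta}_{1,x}[f^{p}(x)]<\infty$ and $\mathcal{H}^{\alpha,\beta}_{1,x}[g^{p}(x)]<\infty$. Let $x>1$ and let $m,M$ be real constants such that $0<m\le \frac{f(\tau)}{g(\tau)}\le M$ for all $\tau\in(1,x)$. Then $$\left[\mathcal{H}^{\alpha,\beta}_{1,x}[f^{p}(x)]\right]^{\frac2p}+\left[\mathcal{H}^{\alpha,\beta}_{1,x}[g^{p}(x)]\right]^{\frac2p}\ge \left(\frac{(M+1)(m+1)}{M}-2\right)\left[\mathcal{H}^{\alpha,\beta}_{1,x}[f^{p}(x)]\right]^{\frac1p}\left[\mathcal{H}^{\alpha,\beta}_{1,x}[g^{p}(x)]\right]^{\frac1p}.$$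
   Context: For $\alpha>0$, $\beta\in(0,1]$ and $x>1$, the one-sided generalized proportional Hadamard fractional integral of a (measurable) function $z$ on $[1,\infty)$ is $$\mathcal{H}^{\alpha,\beta}_{1,x}[z(x)]=(\mathcal{H}^{\alpha,\beta}_{1,x}z)(x)=\frac{1}{\beta^{\alpha}\Gamma(\alpha)}\int_{1}^{x}e^{\frac{\beta-1}{\beta}(\ln x-\ln t)}(\ln x-\ln t)^{\alpha-1}\frac{z(t)}{t}\,dt,$$ where $\Gamma$ is the gamma function. Functions are real-valued and measurable, and $f^p(x)$ means $(f(x))^p$. *)

theory Defs
  imports "HOL-Analysis.Analysis"
begin

definition hadamard_integrand ::
    "real \<Rightarrow> real \<Rightarrow> real \<Rightarrow> (real \<Rightarrow> real) \<Rightarrow> real \<Rightarrow> real" where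
  "hadamard_integrand \<alpha> \<beta> x z t =
     exp ((\<beta> - 1) / \<beta> * (ln x - ln t)) * (ln x - ln t) powr (\<alpha> - 1) * (z t / t)"

(* The Lebesgue integral is total and is 0 for a non-integrable function, so the
   condition that the fractional integral of a nonnegative function is finite is
   kept separately in hadamard_finite. *)
definition hadamard_integral ::
    "real \<Rightarrow> real \<Rightarrow> (real \<Rightarrow> real) \<Rightarrow> real \<Rightarrow> real" where
  "hadamard_integral \<alpha> \<beta> z x =
     1 / (\<beta> powr \<alpha> * Gamma \<alpha>) * (LINT t:{1..x}|lebesgue. hadamard_integrand \<alpha> \<beta> x z t)"

definition hadamard_finite ::
    "real \<Rightarrow> real \<Rightarrow> (real \<Rightarrow> real) \<Rightarrow> real \<Rightarrow> bool" where
  "hadamard_finite \<alpha> \<beta> z x \<longleftrightarrow>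
     set_integrable lebesgue {1..x} (hadamard_integrand \<alpha> \<beta> x z)"

end

theory Submission
  imports Defs
begin

text \<open>
  Write \<open>A\<close> and \<open>B\<close> for the \<open>p\<close>-th roots of the fractional integrals of \<open>f\<^sup>p\<close> and \<open>g\<^sup>p\<close>; they
  behave like \<open>L\<^sup>p\<close> norms of \<open>f\<close> and \<open>g\<close> for the measure given by the nonnegative Hadamard
  kernel. The operator is linear and monotone, so the pointwise bounds \<open>m g \<le> f \<le> M g\<close> pass to
  these norms: \<open>m B \<le> A \<le> M B\<close>. What remains is an inequality between two real numbers. The
  bound \<open>A \<le> M B\<close> says \<open>(M + 1) A \<le> M (A + B)\<close>, and \<open>m B \<le> A\<close> says \<open>(m + 1) B \<le> A + B\<close>;
  multiplying the two gives \<open>(M + 1) (m + 1) A B \<le> M (A + B)\<^sup>2\<close>, which is the claim after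
  division by \<open>M\<close> and expansion of the square.
\<close>

lemma hadamard_integrand_cmult:
  "hadamard_integrand \<alpha> \<beta> x (\<lambda>t. c * z t) t = c * hadamard_integrand \<alpha> \<beta> x z t"
  by (simp add: hadamard_integrand_def)

lemma hadamard_finite_cmult:
  assumes "hadamard_finite \<alpha> \<beta> z x"
  shows "hadamard_finite \<alpha> \<beta> (\<lambda>t. c * z t) x"
  using assms by (simp add: hadamard_finite_def hadamard_integrand_cmult[abs_def])

lemma hadamard_integral_cmult:
  "hadamard_integral \<alpha> \<beta> (\<lambda>t. c * z t) x = c * hadamard_integral \<alpha> \<beta> z x"
  by (simp add: hadamard_integral_def hadamard_integrand_cmult)

lemma hadamard_integrand_mono:
  assumes "t \<ge> 1" and "u t \<le> v t"
  shows "hadamard_integrand \<alpha> \<beta> x u t \<le> hadamard_integrand \<alpha> \<beta> x v t"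
  unfolding hadamard_integrand_def
  using assms by (intro mult_left_mono divide_right_mono) auto

text \<open>
  The two endpoints form a null set and the Hadamard kernel is nonnegative, so a comparison of the
  functions on the open interval passes to the integrals.
\<close>
lemma hadamard_integral_mono:
  assumes "\<alpha> > 0"
    and u: "hadamard_finite \<alpha> \<beta> u x" and v: "hadamard_finite \<alpha> \<beta> v x"
    and le: "\<And>t. 1 < t \<Longrightarrow> t < x \<Longrightarrow> u t \<le> v t"
  shows "hadamard_integral \<alpha> \<beta> u x \<le> hadamard_integral \<alpha> \<beta> v x"
proof -
  have "AE t in lebesgue. t \<noteq> 1 \<and> t \<noteq> x"
    using AE_completion[OF AE_lborel_singleton[of 1]] AE_completion[OF AE_lborel_singleton[of x]]
    by eventually_elim simp
  then have "AE t in lebesgue. indicator {1..x} t *\<^sub>R hadamard_integrand \<alpha> \<beta> x u t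
      \<le> indicator {1..x} t *\<^sub>R hadamard_integrand \<alpha> \<beta> x v t"
    by eventually_elim
      (auto simp: indicator_def intro!: hadamard_integrand_mono le)
  then have "(LINT t:{1..x}|lebesgue. hadamard_integrand \<alpha> \<beta> x u t)
      \<le> (LINT t:{1..x}|lebesgue. hadamard_integrand \<alpha> \<beta> x v t)"
    using u v unfolding hadamard_finite_def set_integrable_def set_lebesgue_integral_def
    by (intro integral_mono_AE)
  then show ?thesis
    unfolding hadamard_integral_def
    using Gamma_real_pos[OF \<open>\<alpha> > 0\<close>] by (intro mult_left_mono) auto
qed

lemma hadamard_integral_nonneg:
  assumes "\<alpha> > 0" and "hadamard_finite \<alpha> \<beta> z x" and "\<And>t. 1 < t \<Longrightarrow> t < x \<Longrightarrow> 0 \<le> z t"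
  shows "0 \<le> hadamard_integral \<alpha> \<beta> z x"
  using hadamard_integral_mono[of \<alpha> \<beta> "\<lambda>t. 0 * z t" x z]
    hadamard_finite_cmult[of \<alpha> \<beta> z x 0] hadamard_integral_cmult[of \<alpha> \<beta> 0 z x] assms
  by simp

text \<open>
  Raising the pointwise bound to the power \<open>p\<close> turns the constant into \<open>c powr p\<close>, which comes out
  of the integral by linearity; the \<open>p\<close>-th root then gives back \<open>c\<close>. Both sides of the two-sided bound on \<open>f / g\<close> are instances, with the roles
  of the functions exchanged.
\<close>
lemma hadamard_norm_le_cmult:
  assumes "p > 0" and "\<alpha> > 0" and "c \<ge> 0"
    and u: "hadamard_finite \<alpha> \<beta> (\<lambda>t. u t powr p) x"
    and v: "hadamard_finite \<alpha> \<beta> (\<lambda>t. v t powr p) x"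
    and le: "\<And>t. 1 < t \<Longrightarrow> t < x \<Longrightarrow> 0 \<le> u t \<and> 0 \<le> v t \<and> u t \<le> c * v t"
  shows "hadamard_integral \<alpha> \<beta> (\<lambda>t. u t powr p) x powr (1 / p)
      \<le> c * hadamard_integral \<alpha> \<beta> (\<lambda>t. v t powr p) x powr (1 / p)"
proof -
  let ?U = "hadamard_integral \<alpha> \<beta> (\<lambda>t. u t powr p) x"
  let ?V = "hadamard_integral \<alpha> \<beta> (\<lambda>t. v t powr p) x"
  have "u t powr p \<le> c powr p * v t powr p" if "1 < t" "t < x" for t
  proof -
    have "u t powr p \<le> (c * v t) powr p"
      using le[OF that] \<open>p > 0\<close> by (intro powr_mono2) auto
    then show ?thesis
      using le[OF that] \<open>c \<ge> 0\<close> by (simp add: powr_mult)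
  qed
  then have "?U \<le> c powr p * ?V"
    using hadamard_integral_mono[OF \<open>\<alpha> > 0\<close> u hadamard_finite_cmult[OF v, of "c powr p"]]
    by (simp add: hadamard_integral_cmult)
  moreover have "0 \<le> ?U" "0 \<le> ?V"
    using \<open>\<alpha> > 0\<close> u v by (auto intro!: hadamard_integral_nonneg)
  ultimately have "?U powr (1 / p) \<le> (c powr p * ?V) powr (1 / p)"
    using \<open>p > 0\<close> by (intro powr_mono2) auto
  also have "\<dots> = c * ?V powr (1 / p)"
    using \<open>p > 0\<close> \<open>c \<ge> 0\<close> \<open>0 \<le> ?V\<close> by (simp add: powr_mult powr_powr)
  finally show ?thesis .
qed

lemma sum_squares_ge_of_ratio_bounds:
  fixes A B m M :: real
  assumes "0 \<le> A" "0 \<le> B" "0 < m" "0 < M" and "m * B \<le> A" and "A \<le> M * B"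
  shows "((M + 1) * (m + 1) / M - 2) * A * B \<le> A\<^sup>2 + B\<^sup>2"
proof -
  have "((M + 1) * A) * ((m + 1) * B) \<le> (M * (A + B)) * (A + B)"
  proof (rule mult_mono)
    show "(M + 1) * A \<le> M * (A + B)" "(m + 1) * B \<le> A + B"
      using assms by (simp_all add: algebra_simps)
  qed (use assms in auto)
  then have "(M + 1) * (m + 1) * A * B / M \<le> (A + B)\<^sup>2"
    using \<open>0 < M\<close> by (simp add: pos_divide_le_eq power2_eq_square mult_ac)
  then show ?thesis
    by (simp add: power2_sum left_diff_distrib)
qed

theorem theorem3p2:
  fixes p \<alpha> \<beta> x m M :: real and f g :: "real \<Rightarrow> real"
  assumes "p \<ge> 1" and "\<alpha> > 0" and "0 < \<beta>" and "\<beta> \<le> 1"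
    and "f \<in> borel_measurable (lebesgue_on {1..})"
    and "g \<in> borel_measurable (lebesgue_on {1..})"
    and "\<And>t. t \<ge> 1 \<Longrightarrow> f t > 0"
    and "\<And>t. t \<ge> 1 \<Longrightarrow> g t > 0"
    and "\<And>y. y > 1 \<Longrightarrow> hadamard_finite \<alpha> \<beta> (\<lambda>t. f t powr p) y"
    and "\<And>y. y > 1 \<Longrightarrow> hadamard_finite \<alpha> \<beta> (\<lambda>t. g t powr p) y"
    and "x > 1" and "0 < m"
    and "\<And>\<tau>. 1 < \<tau> \<Longrightarrow> \<tau> < x \<Longrightarrow> m \<le> f \<tau> / g \<tau> \<and> f \<tau> / g \<tau> \<le> M"
  shows "hadamard_integral \<alpha> \<beta> (\<lambda>t. f t powr p) x powr (2 / p)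
       + hadamard_integral \<alpha> \<beta> (\<lambda>t. g t powr p) x powr (2 / p)
     \<ge> ((M + 1) * (m + 1) / M - 2)
       * hadamard_integral \<alpha> \<beta> (\<lambda>t. f t powr p) x powr (1 / p)
       * hadamard_integral \<alpha> \<beta> (\<lambda>t. g t powr p) x powr (1 / p)"
proof -
  let ?A = "hadamard_integral \<alpha> \<beta> (\<lambda>t. f t powr p) x powr (1 / p)"
  let ?B = "hadamard_integral \<alpha> \<beta> (\<lambda>t. g t powr p) x powr (1 / p)"
  have bounds: "0 \<le> f t" "0 \<le> g t" "f t \<le> M * g t" "g t \<le> 1 / m * f t"
    if "1 < t" "t < x" for t
    using assms(7)[of t] assms(8)[of t] assms(13)[OF that] that \<open>0 < m\<close>
    by (auto simp: field_simps)
  \<comment> \<open>Evaluating the ratio bounds at the midpoint of the interval shows that \<open>M\<close> is positive.\<close>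
  have "0 < M"
    using assms(13)[of "(1 + x) / 2"] \<open>x > 1\<close> \<open>0 < m\<close> by auto
  have "?A \<le> M * ?B"
    using assms bounds \<open>0 < M\<close> by (intro hadamard_norm_le_cmult) auto
  moreover have "?B \<le> 1 / m * ?A"
    using assms bounds by (intro hadamard_norm_le_cmult) auto
  then have "m * ?B \<le> ?A"
    using \<open>0 < m\<close> by (simp add: field_simps)
  ultimately have "((M + 1) * (m + 1) / M - 2) * ?A * ?B \<le> ?A\<^sup>2 + ?B\<^sup>2"
    using \<open>0 < m\<close> \<open>0 < M\<close> by (intro sum_squares_ge_of_ratio_bounds) auto
  moreover have "y powr (2 / p) = (y powr (1 / p))\<^sup>2" for y :: real
    by (simp add: power2_eq_square flip: powr_add)
  ultimately show ?thesis
    by simp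
qed

end
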